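(* Let $X$ be a visual Gromov hyperbolic space, with its boundary at infinity $\partial_\infty X$ endowed with a visual metric. Then $$\operatorname{\ell-asdim}X\le\operatorname{\ell-dim}(\partial_\infty X\times[0,1]).$$
   Context: Products of metric spaces carry the $l_\infty$-metric (maximum of the distances in the factors). Hyperbolicity. For $o,x,x'$ in a metric space $X$, the Gromov product is $(x|x')_o=\frac12(|xo|+|x'o|-|xx'|)$. $X$ is $\delta$-hyperbolic if $(x|y)_o\ge\min\{(x|z)_o,(z|y)_o\}-\delta$ for all $o,x,y,z\in X$; it is (Gromov) hyperbolic if it is $\delta$-hyperbolic for some $\delta\ge0$. $\partial_\infty X$ is the Gromov boundary at infinity; the Gromov product based at $o$ extends in the standard way to $\partial_\infty X$. A metric $d$ on $\partial_\infty X$ is visual if there are $o\in X$, $a>1$ and constants $c_1,c_2>0$ with $c_1a^{-(\xi|\xi')_o}\le d(\xi,\xi')\le c_2a^{-(\xi|\xi')_o}$ for all $\xi,\xi'\in\partial_\infty X$. A hyperbolic space $X$ is visual if for some base point $x_0\in X$ there is $D>0$ such that for every $x\in X$ there is $\xi\in\partial_\infty X$ with $|xx_0|\le(x|\xi)_{x_0}+D$. Coverings. For a family $\mathcal U$ of subsets of a metric space $Z$: $\operatorname{mesh}(\mathcal U)=\sup\{\operatorname{diam}U:U\in\mathcal U\}$; $\mathcal U$ is disjoint if its members are pairwise disjoint; a covering is $m$-colored if it is the union of $m$ disjoint families. The Lebesgue number of an open covering $\mathcal U$ of $Z$ is $L(\mathcal U)=\inf_{z\in Z}\sup\{\operatorname{dist}(z,Z\setminus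 U):U\in\mathcal U\}$. An $(L,M,n)$-covering is an $n$-colored open covering $\mathcal U$ with $\operatorname{mesh}(\mathcal U)\le M$ and $L(\mathcal U)\ge L$. Dimensions. $\operatorname{\ell-dim}(Z)$ (linearly controlled dimension) is the minimal integer $m\ge0$ for which there is $\delta\in(0,1)$ such that for every sufficiently small $\tau>0$ there is an open $(\delta\tau,\tau,m+1)$-covering of $Z$. $\operatorname{\ell-asdim}X$ (linearly controlled asymptotic dimension) is the minimal integer $n\ge0$ for which there is $C>1$ such that for every sufficiently large $d$ there is an open $(d,Cd,n+1)$-covering of $X$. Each is $\infty$ if no such integer exists. *)

theory Defs
  imports "HOL-Analysis.Analysis"
begin

context Metric_space
begin

subsection \<open>Gromov hyperbolicity and the boundary at infinity\<close>

definition gromov_product :: "'a \<Rightarrow> 'a \<Rightarrow> 'a \<Rightarrow> real" where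
  "gromov_product p x y = (d x p + d y p - d x y) / 2"

definition delta_hyperbolic :: "real \<Rightarrow> bool" where
  "delta_hyperbolic \<delta> \<longleftrightarrow>
     (\<forall>p\<in>M. \<forall>x\<in>M. \<forall>y\<in>M. \<forall>z\<in>M.
        gromov_product p x y \<ge> min (gromov_product p x z) (gromov_product p z y) - \<delta>)"

definition gromov_hyperbolic :: bool where
  "gromov_hyperbolic \<longleftrightarrow> (\<exists>\<delta>\<ge>0. delta_hyperbolic \<delta>)"

text \<open>
  Changing the base point changes Gromov products by at most the distance of the base points, so
  in the next two definitions ``for some base point'' is the same as ``for every base point''.
\<close>

definition converges_to_infinity :: "(nat \<Rightarrow> 'a) \<Rightarrow> bool" where
  "converges_to_infinity xs \<longleftrightarrow> range xs \<subseteq> M \<and>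
     (\<exists>p\<in>M. filterlim (\<lambda>(i, j). gromov_product p (xs i) (xs j)) at_top
              (sequentially \<times>\<^sub>F sequentially))"

definition boundary_rel :: "((nat \<Rightarrow> 'a) \<times> (nat \<Rightarrow> 'a)) set" where
  "boundary_rel = {(xs, ys). converges_to_infinity xs \<and> converges_to_infinity ys \<and>
     (\<exists>p\<in>M. filterlim (\<lambda>i. gromov_product p (xs i) (ys i)) at_top sequentially)}"

definition boundary_at_infinity :: "(nat \<Rightarrow> 'a) set set" where
  "boundary_at_infinity = Collect converges_to_infinity // boundary_rel"

text \<open>
  The Gromov product is extended to the boundary by taking the infimum of the lower limits over all
  representing sequences.  It takes the value \<open>\<infinity>\<close> on the diagonal of the boundary.
\<close>

definition gromov_product_point_bd :: "'a \<Rightarrow> 'a \<Rightarrow> (nat \<Rightarrow> 'a) set \<Rightarrow> ereal" where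
  "gromov_product_point_bd p x \<xi> =
     (INF xs\<in>\<xi>. liminf (\<lambda>i. ereal (gromov_product p x (xs i))))"

definition gromov_product_bd :: "'a \<Rightarrow> (nat \<Rightarrow> 'a) set \<Rightarrow> (nat \<Rightarrow> 'a) set \<Rightarrow> ereal" where
  "gromov_product_bd p \<xi> \<eta> =
     (INF xs\<in>\<xi>. INF ys\<in>\<eta>. liminf (\<lambda>i. ereal (gromov_product p (xs i) (ys i))))"

text \<open>The power \<open>a\<close> to the \<open>-t\<close>, for \<open>t\<close> in \<open>[0, \<infinity>]\<close> and \<open>a > 1\<close>.\<close>

definition exp_neg :: "real \<Rightarrow> ereal \<Rightarrow> real" where
  "exp_neg a t = (if t = \<infinity> then 0 else a powr (- real_of_ereal t))"

definition visual_metric :: "((nat \<Rightarrow> 'a) set \<Rightarrow> (nat \<Rightarrow> 'a) set \<Rightarrow> real) \<Rightarrow> bool" where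
  "visual_metric \<rho> \<longleftrightarrow> Metric_space boundary_at_infinity \<rho> \<and>
     (\<exists>p\<in>M. \<exists>a>1. \<exists>c\<^sub>1>0. \<exists>c\<^sub>2>0.
        \<forall>\<xi>\<in>boundary_at_infinity. \<forall>\<eta>\<in>boundary_at_infinity.
          c\<^sub>1 * exp_neg a (gromov_product_bd p \<xi> \<eta>) \<le> \<rho> \<xi> \<eta> \<and>
          \<rho> \<xi> \<eta> \<le> c\<^sub>2 * exp_neg a (gromov_product_bd p \<xi> \<eta>))"

definition visual_space :: bool where
  "visual_space \<longleftrightarrow>
     (\<exists>x\<^sub>0\<in>M. \<exists>D>0. \<forall>x\<in>M. \<exists>\<xi>\<in>boundary_at_infinity.
        ereal (d x x\<^sub>0) \<le> gromov_product_point_bd x\<^sub>0 x \<xi> + ereal D)"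

subsection \<open>Coverings\<close>

definition mesh :: "'a set set \<Rightarrow> ennreal" where
  "mesh \<U> = (SUP U\<in>\<U>. SUP x\<in>U. SUP y\<in>U. ennreal (d x y))"

text \<open>The distance of a point to the empty set is \<open>\<infinity>\<close>.\<close>

definition dist_to_set :: "'a \<Rightarrow> 'a set \<Rightarrow> ennreal" where
  "dist_to_set z A = (INF y\<in>A. ennreal (d z y))"

definition lebesgue_number :: "'a set set \<Rightarrow> ennreal" where
  "lebesgue_number \<U> = (INF z\<in>M. SUP U\<in>\<U>. dist_to_set z (M - U))"

definition open_covering :: "'a set set \<Rightarrow> bool" where
  "open_covering \<U> \<longleftrightarrow> (\<forall>U\<in>\<U>. openin mtopology U) \<and> \<Union>\<U> = M"

definition colored :: "nat \<Rightarrow> 'a set set \<Rightarrow> bool" where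
  "colored m \<U> \<longleftrightarrow> (\<exists>\<F>. \<U> = (\<Union>i<m. \<F> i) \<and> (\<forall>i<m. disjoint (\<F> i)))"

definition LMn_covering :: "real \<Rightarrow> real \<Rightarrow> nat \<Rightarrow> 'a set set \<Rightarrow> bool" where
  "LMn_covering l m n \<U> \<longleftrightarrow> open_covering \<U> \<and> colored n \<U> \<and>
     mesh \<U> \<le> ennreal m \<and> lebesgue_number \<U> \<ge> ennreal l"

subsection \<open>Linearly controlled dimensions\<close>

text \<open>An infimum in \<^typ>\<open>enat\<close> is a minimum, or \<open>\<infinity>\<close> for the empty set.\<close>

definition l_dim :: enat where
  "l_dim = Inf {enat m | m. \<exists>\<delta>. 0 < \<delta> \<and> \<delta> < 1 \<and>
     (\<forall>\<^sub>F \<tau> in at_right 0. \<exists>\<U>. LMn_covering (\<delta> * \<tau>) \<tau> (m + 1) \<U>)}"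

definition l_asdim :: enat where
  "l_asdim = Inf {enat n | n. \<exists>C>1.
     \<forall>\<^sub>F t in at_top. \<exists>\<U>. LMn_covering t (C * t) (n + 1) \<U>}"

end

subsection \<open>Products with the maximum metric\<close>

definition max_metric ::
    "('a \<Rightarrow> 'a \<Rightarrow> real) \<Rightarrow> ('b \<Rightarrow> 'b \<Rightarrow> real) \<Rightarrow> 'a \<times> 'b \<Rightarrow> 'a \<times> 'b \<Rightarrow> real" where
  "max_metric d\<^sub>1 d\<^sub>2 p q = max (d\<^sub>1 (fst p) (fst q)) (d\<^sub>2 (snd p) (snd q))"

lemma Metric_space_max_metric:
  assumes "Metric_space A d\<^sub>1" and "Metric_space B d\<^sub>2"
  shows "Metric_space (A \<times> B) (max_metric d\<^sub>1 d\<^sub>2)"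
proof -
  interpret A: Metric_space A d\<^sub>1 by fact
  interpret B: Metric_space B d\<^sub>2 by fact
  show ?thesis
  proof
    fix x y
    show "0 \<le> max_metric d\<^sub>1 d\<^sub>2 x y"
      by (simp add: max_metric_def le_max_iff_disj)
    show "max_metric d\<^sub>1 d\<^sub>2 x y = max_metric d\<^sub>1 d\<^sub>2 y x"
      by (simp add: max_metric_def A.commute B.commute)
  next
    fix x y assume xy: "x \<in> A \<times> B" "y \<in> A \<times> B"
    have "max_metric d\<^sub>1 d\<^sub>2 x y = 0 \<longleftrightarrow> d\<^sub>1 (fst x) (fst y) = 0 \<and> d\<^sub>2 (snd x) (snd y) = 0"
      using A.nonneg[of "fst x" "fst y"] B.nonneg[of "snd x" "snd y"]
      unfolding max_metric_def by linarith
    then show "max_metric d\<^sub>1 d\<^sub>2 x y = 0 \<longleftrightarrow> x = y"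
      using xy by (auto simp: prod_eq_iff mem_Times_iff)
  next
    fix x y z assume "x \<in> A \<times> B" "y \<in> A \<times> B" "z \<in> A \<times> B"
    then show "max_metric d\<^sub>1 d\<^sub>2 x z \<le> max_metric d\<^sub>1 d\<^sub>2 x y + max_metric d\<^sub>1 d\<^sub>2 y z"
      using A.triangle[of "fst x" "fst y" "fst z"] B.triangle[of "snd x" "snd y" "snd z"]
      unfolding max_metric_def mem_Times_iff by linarith
  qed
qed

end

theory Submission
  imports Defs
begin

text \<open>
  From far away a visual hyperbolic space looks like a cone over its boundary \<open>Z\<close>: with \<open>b\<close> a base
  point, a point \<open>x\<close> is described by a boundary point \<open>\<phi> x\<close> almost behind it and by the distance
  from \<open>x\<close> to \<open>b\<close>.  A ball of radius \<open>t\<close> about \<open>x\<close> has a shadow in \<open>Z\<close> of size at most a constant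
  times \<open>a powr (t - d x b)\<close>, and conversely two points are close if their distances to \<open>b\<close> are
  comparable and their shadows are near each other at the right scale (\<open>boundary_projection\<close>).

  Cut the space into slabs according to the distance to \<open>b\<close>, each of width a large constant multiple
  of \<open>t\<close>.  Within one slab all distances to \<open>b\<close> agree up to a multiple of \<open>t\<close>, so one scale \<open>\<tau>\<close>
  suits the whole slab, and a covering of \<open>Z \<times> [0,1]\<close> at this scale can be pulled back, the second
  coordinate being a rescaled distance to \<open>b\<close> (\<open>slab_family_exists\<close>).  This gives the right number of
  colours, a Lebesgue number at least \<open>t\<close> and sets of diameter \<open>O(t)\<close>, for each slab separately.

  To join the slabs without new colours, let consecutive ones overlap, and let every set absorb the
  sets of its colour in the next slab that it meets.  The sets further out are at a much finer scale
  in \<open>Z\<close>, hence meet at most one set of their colour in the slab before.  The interval factor ensures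
  that absorption stops after one step: the slab occupies a length \<open>2 * \<tau>\<close> of the interval, so sets of
  diameter at most \<open>\<tau>\<close> cannot reach from the slab before to the slab after.  With a covering of \<open>Z\<close>
  alone every set would run through the whole slab, and absorption would pile up without bound.
  Absorption therefore keeps each colour disjoint (\<open>disjoint_glued\<close>) and at most triples the diameters.
\<close>

section \<open>Coverings\<close>

context Metric_space
begin

text \<open>
  Shrinking every member by a fraction of the Lebesgue number keeps the covering property and
  moves distinct members of one colour apart by a definite amount.
\<close>

lemma LMn_covering_separated:
  assumes cov: "LMn_covering l \<tau> n \<U>" and l: "l > 0" and \<tau>: "\<tau> \<ge> 0"
  obtains \<A> :: "nat \<Rightarrow> 'a set set"
  where "\<And>c A x y. c < n \<Longrightarrow> A \<in> \<A> c \<Longrightarrow> x \<in> A \<Longrightarrow> y \<in> A \<Longrightarrow> d x y \<le> \<tau>"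
    and "\<And>c A B x y. c < n \<Longrightarrow> A \<in> \<A> c \<Longrightarrow> B \<in> \<A> c \<Longrightarrow> A \<noteq> B \<Longrightarrow> x \<in> A \<Longrightarrow> y \<in> B
           \<Longrightarrow> l / 4 \<le> d x y"
    and "\<And>z. z \<in> M \<Longrightarrow> \<exists>c<n. \<exists>A\<in>\<A> c. mball z (l / 4) \<subseteq> A"
proof -
  obtain \<F> where \<U>: "\<U> = (\<Union>i<n. \<F> i)" and disj: "\<And>i. i < n \<Longrightarrow> disjoint (\<F> i)"
    using cov unfolding LMn_covering_def colored_def by blast
  \<comment> \<open>The supremum in the Lebesgue number need not be attained, so only balls of radius \<open>l / 2\<close> are
    known to lie in members of \<open>\<U>\<close>; half of this is spent on the shrinking.\<close>
  define core where "core U = {z\<in>M. mball z (l / 4) \<subseteq> U}" for U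
  have core_sub: "core U \<subseteq> U" for U
    using l by (auto simp: core_def)
  show thesis
  proof (rule that[of "\<lambda>c. core ` \<F> c"])
    fix c A x y
    assume c: "c < n" and "A \<in> core ` \<F> c" "x \<in> A" "y \<in> A"
    then obtain U where U: "U \<in> \<F> c" "x \<in> U" "y \<in> U"
      using core_sub by blast
    then have "ennreal (d x y) \<le> mesh \<U>"
      unfolding mesh_def \<U> using c by (intro SUP_upper2[of U] SUP_upper2[of x] SUP_upper2[of y]) auto
    also have "\<dots> \<le> ennreal \<tau>"
      using cov by (simp add: LMn_covering_def)
    finally show "d x y \<le> \<tau>"
      using \<tau> by (simp add: ennreal_le_iff)
  next
    fix c A B x y
    assume c: "c < n" and A: "A \<in> core ` \<F> c" and B: "B \<in> core ` \<F> c"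
      and ne: "A \<noteq> B" and x: "x \<in> A" and y: "y \<in> B"
    obtain U where U: "U \<in> \<F> c" "A = core U" using A by blast
    obtain V where V: "V \<in> \<F> c" "B = core V" using B by blast
    have "U \<inter> V = {}"
      using disj[OF c] U V ne by (metis disjointD)
    moreover have "y \<in> V" using y V core_sub by blast
    ultimately have "y \<notin> mball x (l / 4)"
      using x U by (auto simp: core_def)
    then show "l / 4 \<le> d x y"
      using x y U V by (auto simp: core_def)
  next
    fix z assume z: "z \<in> M"
    have "ennreal (l / 2) < ennreal l"
      using l by (simp add: ennreal_less_iff)
    also have "\<dots> \<le> lebesgue_number \<U>"
      using cov by (simp add: LMn_covering_def)
    also have "\<dots> \<le> (SUP U\<in>\<U>. dist_to_set z (M - U))"
      unfolding lebesgue_number_def using z by (rule INF_lower)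
    finally obtain U where U: "U \<in> \<U>" and dist: "ennreal (l / 2) < dist_to_set z (M - U)"
      by (auto simp: less_SUP_iff)
    have far: "l / 2 < d z y" if "y \<in> M - U" for y
    proof -
      have "dist_to_set z (M - U) \<le> ennreal (d z y)"
        unfolding dist_to_set_def using that by (rule INF_lower)
      with dist have "ennreal (l / 2) < ennreal (d z y)" by simp
      then show ?thesis using l by (simp add: ennreal_less_iff)
    qed
    have "mball z (l / 4) \<subseteq> core U"
    proof
      fix w assume w: "w \<in> mball z (l / 4)"
      have "v \<in> U" if "v \<in> mball w (l / 4)" for v
        using that w triangle[of z w v] far[of v] by fastforce
      with w show "w \<in> core U" by (auto simp: core_def)
    qed
    with U show "\<exists>c<n. \<exists>A\<in>core ` \<F> c. mball z (l / 4) \<subseteq> A"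
      unfolding \<U> by blast
  qed
qed

text \<open>
  A ball contained in a set lies in its interior, so coloured families of arbitrary sets serve as
  well as open ones.
\<close>

lemma LMn_covering_interiors:
  assumes disj: "\<And>c. c < n \<Longrightarrow> disjoint (\<G> c)"
    and diam: "\<And>c U x y. c < n \<Longrightarrow> U \<in> \<G> c \<Longrightarrow> x \<in> U \<Longrightarrow> y \<in> U \<Longrightarrow> d x y \<le> m"
    and ball: "\<And>x. x \<in> M \<Longrightarrow> \<exists>c<n. \<exists>U\<in>\<G> c. mball x l \<subseteq> U"
    and l: "l > 0"
  shows "\<exists>\<U>. LMn_covering l m n \<U>"
proof -
  define I where "I U = mtopology interior_of U" for U
  have I_sub: "I U \<subseteq> U" and I_M: "I U \<subseteq> M" for U
    unfolding I_def using interior_of_subset[of mtopology U] interior_of_subset_topspace[of mtopology U] by auto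
  define \<U> where "\<U> = (\<Union>c<n. I ` \<G> c)"
  have ball_I: "\<exists>V\<in>\<U>. mball x l \<subseteq> V" if x: "x \<in> M" for x
  proof -
    obtain c U where "c < n" "U \<in> \<G> c" "mball x l \<subseteq> U"
      using ball[OF x] by blast
    then show ?thesis
      unfolding \<U>_def I_def using interior_of_maximal[of "mball x l" U mtopology] by auto
  qed
  have "open_covering \<U>"
    unfolding open_covering_def
  proof
    show "\<forall>U\<in>\<U>. openin mtopology U" by (auto simp: \<U>_def I_def)
    show "\<Union>\<U> = M"
    proof
      show "\<Union>\<U> \<subseteq> M" using I_M by (auto simp: \<U>_def)
      show "M \<subseteq> \<Union>\<U>" using ball_I centre_in_mball_iff l by blast
    qed
  qed
  moreover have "colored n \<U>"
    unfolding colored_def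
  proof (intro exI[of _ "\<lambda>c. I ` \<G> c"] conjI allI impI)
    show "\<U> = (\<Union>c<n. I ` \<G> c)" by (rule \<U>_def)
    fix c assume c: "c < n"
    show "disjoint (I ` \<G> c)"
      using disj[OF c] I_sub unfolding pairwise_def disjnt_def by fast
  qed
  moreover have "mesh \<U> \<le> ennreal m"
    unfolding mesh_def \<U>_def using diam I_sub
    by (intro SUP_least ennreal_leI) blast
  moreover have "lebesgue_number \<U> \<ge> ennreal l"
    unfolding lebesgue_number_def
  proof (rule INF_greatest)
    fix x assume x: "x \<in> M"
    obtain V where V: "V \<in> \<U>" "mball x l \<subseteq> V"
      using ball_I[OF x] by blast
    have "ennreal l \<le> dist_to_set x (M - V)"
      unfolding dist_to_set_def using V x by (intro INF_greatest ennreal_leI) (force simp: subset_iff)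
    with V show "ennreal l \<le> (SUP U\<in>\<U>. dist_to_set x (M - U))"
      by (blast intro: SUP_upper2)
  qed
  ultimately show ?thesis
    unfolding LMn_covering_def by blast
qed

end

section \<open>Gluing families of consecutive levels\<close>

definition unabsorbed :: "(nat \<Rightarrow> 'a set set) \<Rightarrow> nat \<Rightarrow> 'a set \<Rightarrow> bool" where
  "unabsorbed F k U \<longleftrightarrow> U \<in> F k \<and> (\<forall>j W. k = Suc j \<longrightarrow> W \<in> F j \<longrightarrow> W \<inter> U = {})"

definition absorb :: "(nat \<Rightarrow> 'a set set) \<Rightarrow> nat \<Rightarrow> 'a set \<Rightarrow> 'a set" where
  "absorb F k U = U \<union> \<Union>{V \<in> F (Suc k). V \<inter> U \<noteq> {}}"

definition glued :: "(nat \<Rightarrow> 'a set set) \<Rightarrow> 'a set set" where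
  "glued F = {absorb F k U | k U. unabsorbed F k U}"

text \<open>
  By \<open>no_chain\<close>, a set that has been absorbed absorbs nothing itself, so each set has a final place
  after one step; by \<open>unique\<close>, that place is determined.
\<close>

locale gluing =
  fixes F :: "nat \<Rightarrow> 'a set set"
  assumes disj: "disjoint (F k)"
    and far: "k + 2 \<le> l \<Longrightarrow> U \<in> F k \<Longrightarrow> V \<in> F l \<Longrightarrow> U \<inter> V = {}"
    and unique: "U \<in> F k \<Longrightarrow> U' \<in> F k \<Longrightarrow> V \<in> F (Suc k) \<Longrightarrow> V \<inter> U \<noteq> {} \<Longrightarrow> V \<inter> U' \<noteq> {} \<Longrightarrow> U = U'"
    and no_chain: "U \<in> F k \<Longrightarrow> V \<in> F (Suc k) \<Longrightarrow> W \<in> F (Suc (Suc k)) \<Longrightarrow> V \<inter> U \<noteq> {} \<Longrightarrow> W \<inter> V = {}"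
begin

lemma subset_glued:
  assumes U: "U \<in> F k"
  shows "\<exists>G\<in>glued F. U \<subseteq> G"
proof (cases "unabsorbed F k U")
  case True
  then show ?thesis unfolding glued_def absorb_def by blast
next
  case False
  then obtain j W where j: "k = Suc j" "W \<in> F j" "W \<inter> U \<noteq> {}"
    using U by (auto simp: unabsorbed_def)
  have "unabsorbed F j W"
    unfolding unabsorbed_def using j U no_chain by blast
  moreover have "U \<subseteq> absorb F j W"
    unfolding absorb_def using j U by blast
  ultimately show ?thesis unfolding glued_def by blast
qed

lemma absorb_cases:
  assumes "x \<in> absorb F k U" "unabsorbed F k U"
  obtains "x \<in> U" | V where "V \<in> F (Suc k)" "V \<inter> U \<noteq> {}" "x \<in> V"
  using assms unfolding absorb_def by blast

text \<open>
  Sets through a common point lie on the same or on consecutive levels.  If on the same level, they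
  are equal; if on consecutive levels, the outer one is absorbed by the inner one, which is then
  itself unabsorbed.  Either way one set meets or equals both \<open>U\<close> and \<open>U'\<close>, and these agree by
  \<open>unique\<close> or disjointness.
\<close>

lemma meeting_absorb_le:
  assumes U: "unabsorbed F k U" and U': "unabsorbed F l U'" and "k \<le> l"
    and x: "x \<in> absorb F k U" and x': "x \<in> absorb F l U'"
  shows "k = l \<and> U = U'"
proof -
  have UF: "U \<in> F k" and UF': "U' \<in> F l" using U U' by (auto simp: unabsorbed_def)
  note same = disj[unfolded pairwise_def disjnt_def, rule_format]
  show ?thesis
    using x U
  proof (cases rule: absorb_cases)
    case 1
    show ?thesis
      using x' U'
    proof (cases rule: absorb_cases)
      case 11: 1
      have "\<not> k + 2 \<le> l" using far[OF _ UF UF'] 1 11 by blast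
      then have "l = k \<or> l = Suc k" using \<open>k \<le> l\<close> by linarith
      moreover have "l \<noteq> Suc k" using U' UF 1 11 by (auto simp: unabsorbed_def)
      ultimately have "l = k" by simp
      then show ?thesis using same[of U k U'] UF UF' 1 11 by blast
    next
      case (2 V)
      have "\<not> k + 2 \<le> Suc l" using far[OF _ UF 2(1)] 1 2 by blast
      then have "l = k" using \<open>k \<le> l\<close> by linarith
      then show ?thesis using unique[of U k U' V] UF UF' 1 2 by blast
    qed
  next
    case (2 V)
    show ?thesis
      using x' U'
    proof (cases rule: absorb_cases)
      case 1
      have "\<not> Suc k + 2 \<le> l" using far[OF _ 2(1) UF'] 1 2 by blast
      then have "l = k \<or> l = Suc k \<or> l = Suc (Suc k)" using \<open>k \<le> l\<close> by linarith
      moreover have "l \<noteq> Suc (Suc k)" using no_chain[OF UF 2(1) _ 2(2)] UF' 1 2 by blast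
      moreover have "l \<noteq> Suc k"
      proof
        assume l: "l = Suc k"
        then have "V = U'" using same[of V "Suc k" U'] UF' 1 2 by blast
        then show False using U' UF 2 l by (auto simp: unabsorbed_def)
      qed
      ultimately have "l = k" by simp
      then show ?thesis using unique[of U k U' V] UF UF' 1 2 by blast
    next
      case V': (2 V')
      have "\<not> Suc k + 2 \<le> Suc l" using far[OF _ 2(1) V'(1)] V' 2 by blast
      then have "l = k \<or> l = Suc k" using \<open>k \<le> l\<close> by linarith
      moreover have "l \<noteq> Suc k" using no_chain[OF UF 2(1) _ 2(2), of V'] V' 2 by blast
      ultimately have l: "l = k" by simp
      then have "V = V'" using same[of V "Suc k" V'] V' 2 by blast
      then show ?thesis using unique[of U k U' V] UF UF' V' 2 l by blast
    qed
  qed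
qed

lemma disjoint_glued: "disjoint (glued F)"
proof (rule pairwiseI)
  fix A B assume "A \<in> glued F" "B \<in> glued F" and ne: "A \<noteq> B"
  then obtain k U l U' where A: "A = absorb F k U" "unabsorbed F k U"
    and B: "B = absorb F l U'" "unabsorbed F l U'"
    unfolding glued_def by blast
  have "A \<inter> B = {}"
    using meeting_absorb_le[OF A(2) B(2)] meeting_absorb_le[OF B(2) A(2)] A B ne
    by (metis disjoint_iff linear)
  then show "disjnt A B" by (simp add: disjnt_def)
qed

end

lemma (in Metric_space) glued_diam:
  assumes diam: "\<And>k U x y. U \<in> F k \<Longrightarrow> x \<in> U \<Longrightarrow> y \<in> U \<Longrightarrow> d x y \<le> m"
    and sub: "\<And>k U. U \<in> F k \<Longrightarrow> U \<subseteq> M"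
    and G: "G \<in> glued F" and x: "x \<in> G" and y: "y \<in> G" and m: "m \<ge> 0"
  shows "d x y \<le> 3 * m"
proof -
  obtain k U where G: "G = absorb F k U" and U: "U \<in> F k"
    using G by (auto simp: glued_def unabsorbed_def)
  have near: "\<exists>u\<in>U. d z u \<le> m \<and> z \<in> M" if z: "z \<in> G" for z
  proof (cases "z \<in> U")
    case True
    then show ?thesis using sub[OF U] m by (intro bexI[of _ z]) auto
  next
    case False
    then obtain V u where V: "V \<in> F (Suc k)" "z \<in> V" "u \<in> V" "u \<in> U"
      using z unfolding G absorb_def by blast
    then show ?thesis using diam[OF V(1-3)] sub[OF V(1)] by blast
  qed
  obtain u where u: "u \<in> U" "d x u \<le> m" "x \<in> M" using near[OF x] by blast
  obtain v where v: "v \<in> U" "d y v \<le> m" "y \<in> M" using near[OF y] by blast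
  have "u \<in> M" "v \<in> M" using sub U u v by blast+
  then show ?thesis
    using triangle[of x u y] triangle[of u v y] diam[OF U u(1) v(1)] u v commute[of v y] by linarith
qed

section \<open>The projection to the boundary\<close>

context Metric_space
begin

lemma gromov_product_nonneg:
  "p \<in> M \<Longrightarrow> x \<in> M \<Longrightarrow> y \<in> M \<Longrightarrow> 0 \<le> gromov_product p x y"
  unfolding gromov_product_def using triangle[of x p y] commute[of y p] by simp

lemma gromov_product_commute: "gromov_product p x y = gromov_product p y x"
  unfolding gromov_product_def by (simp add: commute add.commute)

lemma gromov_product_change_base:
  assumes "p \<in> M" "q \<in> M" "x \<in> M" "y \<in> M"
  shows "gromov_product q x y - d p q \<le> gromov_product p x y"
  unfolding gromov_product_def
  using triangle[of x p q] triangle[of y p q] assms by (simp add: field_simps)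

lemma delta_hyperbolic_chain:
  assumes "delta_hyperbolic \<delta>" "p \<in> M" "x \<in> M" "u \<in> M" "v \<in> M" "y \<in> M"
  shows "min (gromov_product p x u) (min (gromov_product p u v) (gromov_product p v y)) - 2 * \<bar>\<delta>\<bar>
    \<le> gromov_product p x y"
proof -
  have "min (gromov_product p x u) (gromov_product p u y) - \<delta> \<le> gromov_product p x y"
    and "min (gromov_product p u v) (gromov_product p v y) - \<delta> \<le> gromov_product p u y"
    using assms unfolding delta_hyperbolic_def by blast+
  then show ?thesis by linarith
qed

lemma boundary_sequence:
  assumes "\<xi> \<in> boundary_at_infinity" and "xs \<in> \<xi>"
  shows "xs i \<in> M"
  using assms unfolding boundary_at_infinity_def quotient_def boundary_rel_def
    converges_to_infinity_def by auto

lemma boundary_nonempty: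
  assumes "\<xi> \<in> boundary_at_infinity"
  obtains xs where "xs \<in> \<xi>"
proof -
  obtain xs where xs: "converges_to_infinity xs" and \<xi>: "\<xi> = boundary_rel `` {xs}"
    using assms unfolding boundary_at_infinity_def quotient_def by auto
  then obtain p where p: "p \<in> M"
    and lim: "filterlim (\<lambda>(i, j). gromov_product p (xs i) (xs j)) at_top
      (sequentially \<times>\<^sub>F sequentially)"
    unfolding converges_to_infinity_def by blast
  have "filterlim (\<lambda>i. (i, i)) (sequentially \<times>\<^sub>F sequentially) sequentially"
    by (intro filterlim_Pair filterlim_ident)
  from filterlim_compose[OF lim this]
  have "filterlim (\<lambda>i. gromov_product p (xs i) (xs i)) at_top sequentially"
    by simp
  then have "xs \<in> \<xi>"
    using xs p unfolding \<xi> boundary_rel_def by blast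
  then show thesis by (rule that)
qed

lemma exp_neg_le:
  assumes "a > 1" and "ereal g \<le> t"
  shows "exp_neg a t \<le> a powr (- g)"
  using assms by (cases t) (auto simp: exp_neg_def)

lemma exp_neg_leD:
  assumes "a > 1" and "0 \<le> t" and "exp_neg a t \<le> a powr (- g)"
  shows "ereal g \<le> t"
  using assms by (cases t) (auto simp: exp_neg_def)

lemma eventually_gromov_product_point_bd:
  assumes "ereal r \<le> gromov_product_point_bd p x \<xi> + ereal D" and "xs \<in> \<xi>"
  shows "\<forall>\<^sub>F i in sequentially. r - D - 1 < gromov_product p x (xs i)"
proof -
  have "ereal (r - D - 1) < gromov_product_point_bd p x \<xi>"
    using assms(1) by (cases "gromov_product_point_bd p x \<xi>") auto
  also have "\<dots> \<le> liminf (\<lambda>i. ereal (gromov_product p x (xs i)))"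
    unfolding gromov_product_point_bd_def using assms(2) by (rule INF_lower)
  finally have "\<forall>\<^sub>F i in sequentially. ereal (r - D - 1) < ereal (gromov_product p x (xs i))"
    by (rule less_LiminfD)
  then show ?thesis by simp
qed

lemma eventually_gromov_product_bd:
  assumes "ereal g \<le> gromov_product_bd p \<xi> \<eta>" and "xs \<in> \<xi>" "ys \<in> \<eta>"
  shows "\<forall>\<^sub>F i in sequentially. g - 1 < gromov_product p (xs i) (ys i)"
proof -
  have "ereal (g - 1) < gromov_product_bd p \<xi> \<eta>"
    using less_le_trans[OF _ assms(1), of "ereal (g - 1)"] by simp
  also have "\<dots> \<le> liminf (\<lambda>i. ereal (gromov_product p (xs i) (ys i)))"
    unfolding gromov_product_bd_def using assms(2,3)
    by (meson INF_lower INF_lower2)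
  finally have "\<forall>\<^sub>F i in sequentially. ereal (g - 1) < ereal (gromov_product p (xs i) (ys i))"
    by (rule less_LiminfD)
  then show ?thesis by simp
qed

text \<open>
  Visuality provides for every point \<open>x\<close> a boundary point \<open>\<phi> x\<close> such that \<open>x\<close> lies almost on the way
  from \<open>b\<close> to \<open>\<phi> x\<close>, that is, \<open>(x|\<phi> x)\<^sub>b\<close> is \<open>d x b\<close> up to a constant.  Hyperbolicity along the chain
  \<open>x, \<phi> x, \<phi> y, y\<close> then bounds \<open>(x|y)\<^sub>b\<close> from below by the minimum of \<open>d x b\<close>, \<open>d y b\<close> and
  \<open>(\<phi> x|\<phi> y)\<^sub>b\<close>, and along \<open>\<phi> x, x, y, \<phi> y\<close> it bounds \<open>(\<phi> x|\<phi> y)\<^sub>b\<close> by the minimum of \<open>d x b\<close>,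
  \<open>d y b\<close> and \<open>(x|y)\<^sub>b\<close>, up to constants.  The two estimates express this by distances.
\<close>

lemma boundary_projection:
  assumes hyp: gromov_hyperbolic and vis: visual_space and met: "visual_metric \<rho>"
  obtains b \<phi> a K where "b \<in> M" "a > 1" "K \<ge> 0" "\<And>x. x \<in> M \<Longrightarrow> \<phi> x \<in> boundary_at_infinity"
    and "\<And>x y. x \<in> M \<Longrightarrow> y \<in> M \<Longrightarrow> \<rho> (\<phi> x) (\<phi> y) \<le> a powr (K + d x y - d x b)"
    and "\<And>x y g. x \<in> M \<Longrightarrow> y \<in> M \<Longrightarrow> \<rho> (\<phi> x) (\<phi> y) \<le> a powr (- g)
      \<Longrightarrow> d x y \<le> d x b + d y b - 2 * min (min (d x b) (d y b)) g + K"
proof -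
  obtain \<delta> where \<delta>: "\<delta> \<ge> 0" "delta_hyperbolic \<delta>"
    using hyp unfolding gromov_hyperbolic_def by blast
  obtain b D where b: "b \<in> M" and D: "D > 0"
    and ex: "\<forall>x\<in>M. \<exists>\<xi>. \<xi> \<in> boundary_at_infinity \<and>
      ereal (d x b) \<le> gromov_product_point_bd b x \<xi> + ereal D"
    using vis unfolding visual_space_def Bex_def by blast
  obtain \<phi> where \<phi>: "\<And>x. x \<in> M \<Longrightarrow> \<phi> x \<in> boundary_at_infinity"
    and \<phi>b: "\<And>x. x \<in> M \<Longrightarrow> ereal (d x b) \<le> gromov_product_point_bd b x (\<phi> x) + ereal D"
    using bchoice[OF ex] by blast
  obtain p a c1 c2 where p: "p \<in> M" and a: "a > 1" and c1: "c1 > 0" and c2: "c2 > 0"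
    and low: "\<And>\<xi> \<eta>. \<xi> \<in> boundary_at_infinity \<Longrightarrow> \<eta> \<in> boundary_at_infinity \<Longrightarrow>
      c1 * exp_neg a (gromov_product_bd p \<xi> \<eta>) \<le> \<rho> \<xi> \<eta>"
    and up: "\<And>\<xi> \<eta>. \<xi> \<in> boundary_at_infinity \<Longrightarrow> \<eta> \<in> boundary_at_infinity \<Longrightarrow>
      \<rho> \<xi> \<eta> \<le> c2 * exp_neg a (gromov_product_bd p \<xi> \<eta>)"
    using met unfolding visual_metric_def by blast
  \<comment> \<open>Losses in the Gromov product: \<open>D + 1\<close> from approximating a point by its boundary sequence,
    \<open>2 * \<delta>\<close> from the hyperbolicity of a chain of length three, and the change of base point.\<close>
  define C where "C = D + 1 + 2 * \<delta> + d p b"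
  define K where "K = 2 * (C + 1 + \<bar>log a c1\<bar> + \<bar>log a c2\<bar>)"
  have C: "C \<ge> 0" using D \<delta> by (simp add: C_def)
  have near: "\<forall>\<^sub>F i in sequentially. d x b - D - 1 < gromov_product b x (xs i)"
    if "x \<in> M" "xs \<in> \<phi> x" for x xs
    using eventually_gromov_product_point_bd \<phi>b that by blast
  show thesis
  proof (rule that[of b a K \<phi>])
    show "b \<in> M" "a > 1" by fact+
    show "K \<ge> 0" using C by (simp add: K_def)
    show "\<phi> x \<in> boundary_at_infinity" if "x \<in> M" for x using \<phi> that .
  next
    fix x y assume x: "x \<in> M" and y: "y \<in> M"
    define g where "g = d x b - d x y - C"
    have "ereal g \<le> gromov_product_bd p (\<phi> x) (\<phi> y)"
      unfolding gromov_product_bd_def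
    proof (intro INF_greatest Liminf_bounded)
      fix xs ys assume xs: "xs \<in> \<phi> x" and ys: "ys \<in> \<phi> y"
      show "\<forall>\<^sub>F i in sequentially. ereal g \<le> ereal (gromov_product p (xs i) (ys i))"
        using near[OF x xs] near[OF y ys]
      proof eventually_elim
        case (elim i)
        have xi: "xs i \<in> M" and yi: "ys i \<in> M"
          using boundary_sequence \<phi> x y xs ys by blast+
        have "d x b - d x y \<le> gromov_product b x y"
          unfolding gromov_product_def using triangle[OF x y b] by (simp add: field_simps)
        moreover have "d x b - d x y \<le> d y b" using triangle[OF x y b] by simp
        ultimately have "d x b - d x y - D - 1 - 2 * \<delta> \<le> gromov_product b (xs i) (ys i)"
          using delta_hyperbolic_chain[OF \<delta>(2) b xi x y yi] elim D \<delta>(1) gromov_product_commute[of b "xs i" x]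
            nonneg[of x y]
          by linarith
        with gromov_product_change_base[OF p b xi yi] show ?case
          by (simp add: g_def C_def)
      qed
    qed
    then have "exp_neg a (gromov_product_bd p (\<phi> x) (\<phi> y)) \<le> a powr (- g)"
      using exp_neg_le a by blast
    then have "\<rho> (\<phi> x) (\<phi> y) \<le> c2 * a powr (- g)"
      using up[OF \<phi>[OF x] \<phi>[OF y]] c2 by (meson less_eq_real_def mult_left_mono order_trans)
    also have "\<dots> = a powr (log a c2 - g)"
      using a c2 by (simp add: powr_diff powr_minus_divide)
    also have "\<dots> \<le> a powr (K + d x y - d x b)"
      using a C by (intro powr_mono) (auto simp: g_def K_def)
    finally show "\<rho> (\<phi> x) (\<phi> y) \<le> a powr (K + d x y - d x b)" .
  next
    fix x y g assume x: "x \<in> M" and y: "y \<in> M" and close: "\<rho> (\<phi> x) (\<phi> y) \<le> a powr (- g)"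
    define h where "h = g + log a c1"
    have "c1 * exp_neg a (gromov_product_bd p (\<phi> x) (\<phi> y)) \<le> a powr (- g)"
      using low[OF \<phi>[OF x] \<phi>[OF y]] close by linarith
    also have "\<dots> = c1 * a powr (- h)"
      using a c1 by (simp add: h_def powr_diff powr_minus_divide powr_add)
    finally have "exp_neg a (gromov_product_bd p (\<phi> x) (\<phi> y)) \<le> a powr (- h)"
      using c1 by simp
    moreover have "0 \<le> gromov_product_bd p (\<phi> x) (\<phi> y)"
      unfolding gromov_product_bd_def
    proof (intro INF_greatest Liminf_bounded always_eventually allI)
      fix xs ys i assume "xs \<in> \<phi> x" "ys \<in> \<phi> y"
      then show "0 \<le> ereal (gromov_product p (xs i) (ys i))"
        using boundary_sequence[OF \<phi>[OF x]] boundary_sequence[OF \<phi>[OF y]] p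
        by (simp add: gromov_product_nonneg)
    qed
    ultimately have h: "ereal h \<le> gromov_product_bd p (\<phi> x) (\<phi> y)"
      using exp_neg_leD a by blast
    obtain xs ys where xs: "xs \<in> \<phi> x" and ys: "ys \<in> \<phi> y"
      using boundary_nonempty \<phi> x y by metis
    have "\<forall>\<^sub>F i in sequentially. d x b - D - 1 < gromov_product b x (xs i) \<and>
        d y b - D - 1 < gromov_product b y (ys i) \<and> h - 1 < gromov_product p (xs i) (ys i)"
      using near[OF x xs] near[OF y ys] eventually_gromov_product_bd[OF h xs ys]
      by eventually_elim blast
    then obtain i where i: "d x b - D - 1 < gromov_product b x (xs i)"
      "d y b - D - 1 < gromov_product b y (ys i)" "h - 1 < gromov_product p (xs i) (ys i)"
      using eventually_happens by force
    have xi: "xs i \<in> M" and yi: "ys i \<in> M"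
      using boundary_sequence \<phi> x y xs ys by blast+
    have "h - 1 - d p b < gromov_product b (xs i) (ys i)"
      using gromov_product_change_base[OF b p xi yi] i(3) commute[of b p] by simp
    then have "g - K / 2 \<le> gromov_product b (xs i) (ys i) - 2 * \<delta>"
      using D by (simp add: h_def K_def C_def field_simps)
    moreover have "D + 1 + 2 * \<delta> \<le> K / 2"
      by (simp add: K_def C_def add_nonneg_nonneg)
    then have "d x b - K / 2 \<le> gromov_product b x (xs i) - 2 * \<delta>"
      and "d y b - K / 2 \<le> gromov_product b (ys i) y - 2 * \<delta>"
      using i(1,2) gromov_product_commute[of b "ys i" y] by simp_all
    ultimately have "min (min (d x b) (d y b)) g - K / 2 \<le> gromov_product b x y"
      using delta_hyperbolic_chain[OF \<delta>(2) b x xi yi y] \<delta>(1) by linarith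
    then show "d x y \<le> d x b + d y b - 2 * min (min (d x b) (d y b)) g + K"
      unfolding gromov_product_def by (simp add: field_simps)
  qed
qed

end

section \<open>Lifting coverings of the boundary times an interval\<close>

text \<open>
  The estimates of \<open>boundary_projection\<close>, for an arbitrary target space.
\<close>

locale hyperbolic_projection = X: Metric_space X d + Z: Metric_space Z \<rho>
  for X :: "'a set" and d and Z :: "'b set" and \<rho> +
  fixes b :: 'a and \<phi> :: "'a \<Rightarrow> 'b" and a K :: real
  assumes b: "b \<in> X" and a: "a > 1" and K: "K \<ge> 0" and \<phi>: "x \<in> X \<Longrightarrow> \<phi> x \<in> Z"
    and image_close: "x \<in> X \<Longrightarrow> y \<in> X \<Longrightarrow> \<rho> (\<phi> x) (\<phi> y) \<le> a powr (K + d x y - d x b)"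
    and preimage_close: "x \<in> X \<Longrightarrow> y \<in> X \<Longrightarrow> \<rho> (\<phi> x) (\<phi> y) \<le> a powr (- g)
      \<Longrightarrow> d x y \<le> d x b + d y b - 2 * min (min (d x b) (d y b)) g + K"
begin

text \<open>
  A slab is the set of points whose distance to \<open>b\<close> lies in \<open>[h, h + w + 2 * t)\<close>; it overlaps the
  next one, which starts at \<open>h + w\<close>.  No member of a slab family meets both overlaps, and members of
  one colour are \<open>\<epsilon>\<close>-separated in \<open>Z\<close> along the upper overlap.  Balls of radius \<open>t\<close> are required to lie
  in a member only if their centre is at least \<open>t\<close> away from both ends; these middle parts of
  consecutive slabs fit together without gaps.
\<close>

definition slab_family :: "real \<Rightarrow> real \<Rightarrow> real \<Rightarrow> real \<Rightarrow> real \<Rightarrow> real \<Rightarrow> nat \<Rightarrow> (nat \<Rightarrow> 'a set set) \<Rightarrow> bool"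
  where "slab_family h w t \<tau> \<epsilon> m n \<F> \<longleftrightarrow>
    (\<forall>c<n. \<forall>U\<in>\<F> c. U \<subseteq> {x\<in>X. h \<le> d x b \<and> d x b < h + w + 2 * t}) \<and>
    (\<forall>c<n. \<forall>U\<in>\<F> c. \<forall>x\<in>U. \<forall>y\<in>U. d x y \<le> m \<and> \<rho> (\<phi> x) (\<phi> y) \<le> \<tau> \<and>
       \<not> (d x b < h + 2 * t \<and> h + w \<le> d y b)) \<and>
    (\<forall>c<n. disjoint (\<F> c)) \<and>
    (\<forall>c<n. \<forall>U\<in>\<F> c. \<forall>V\<in>\<F> c. U \<noteq> V \<longrightarrow>
       (\<forall>x\<in>U. \<forall>y\<in>V. h + w \<le> d x b \<longrightarrow> h + w \<le> d y b \<longrightarrow> \<epsilon> \<le> \<rho> (\<phi> x) (\<phi> y))) \<and>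
    (\<forall>x\<in>X. h + t \<le> d x b \<longrightarrow> d x b < h + w + t \<longrightarrow> (\<exists>c<n. \<exists>U\<in>\<F> c. X.mball x t \<subseteq> U))"

text \<open>
  The covering of \<open>Z \<times> [0,1]\<close> is pulled back by \<open>x \<mapsto> (\<phi> x, s x)\<close>, where \<open>s\<close> grows linearly from
  \<open>0\<close> to \<open>2 * \<tau>\<close> over the length \<open>w\<close> of the slab and stays constant on the overlap with the next one.
  Since \<open>2 * \<tau>\<close> exceeds the mesh, no set of the family reaches both overlaps; since \<open>s\<close> is constant
  on the upper overlap, separation in \<open>Z \<times> [0,1]\<close> is there separation in \<open>Z\<close> alone.
  The scale \<open>\<tau>\<close> is a constant multiple of the size in \<open>Z\<close> of the shadow of a ball of radius \<open>t\<close>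
  centred at distance \<open>h\<close> from \<open>b\<close>; with \<open>w = 16 * t / \<delta>\<close> both coordinates of such a ball vary
  by at most \<open>\<delta> * \<tau> / 8\<close>.
\<close>

lemma slab_family_exists:
  assumes \<delta>: "0 < \<delta>" "\<delta> < 1" and t: "t > 0" and large: "2 * (K + log a (8 / \<delta>)) + K \<le> t"
    and \<tau>_def: "\<tau> = a powr (K + log a (8 / \<delta>) + t - h)" and \<tau>_half: "2 * \<tau> \<le> 1"
    and w_def: "w = 16 / \<delta> * t"
    and cov: "Metric_space.LMn_covering (Z \<times> {0..1::real}) (max_metric \<rho> dist) (\<delta> * \<tau>) \<tau> n \<U>"
  shows "\<exists>\<F>. slab_family h w t \<tau> (\<delta> * \<tau> / 4) (2 * w + 7 * t) n \<F>"
proof -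
  have dist01: "Metric_space {0..1::real} dist"
    by (rule Metric_space.subspace[OF Met_TC.Metric_space_axioms]) simp
  interpret P: Metric_space "Z \<times> {0..1::real}" "max_metric \<rho> dist"
    by (rule Metric_space_max_metric[OF Z.Metric_space_axioms dist01])
  have \<tau>: "\<tau> > 0" and \<delta>\<tau>: "\<delta> * \<tau> > 0" using a \<delta> by (simp_all add: \<tau>_def)
  have w: "w > 0" using t \<delta> by (simp add: w_def)
  have w16: "16 * t \<le> w"
    using t \<delta> by (simp add: w_def field_simps)
  define s where "s x = 2 * \<tau> * max 0 (min 1 ((d x b - h) / w))" for x
  define \<psi> where "\<psi> x = (\<phi> x, s x)" for x
  have s01: "s x \<in> {0..1}" for x
  proof -
    have "s x \<le> 2 * \<tau> * 1" unfolding s_def using \<tau> by (intro mult_left_mono) auto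
    moreover have "0 \<le> s x" unfolding s_def using \<tau> by simp
    ultimately show ?thesis using \<tau>_half by simp
  qed
  have s_top: "s x = 2 * \<tau>" if "h + w \<le> d x b" for x
    using that w by (simp add: s_def field_simps)
  have s_low: "s x \<le> \<tau> / 4" if "d x b < h + 2 * t" for x
  proof -
    have "(d x b - h) / w \<le> 2 * t / (16 * t)"
      using that w16 w t by (intro order_trans[OF divide_right_mono divide_left_mono]) auto
    then have "(d x b - h) / w \<le> 1 / 8" using t by simp
    then have "max 0 (min 1 ((d x b - h) / w)) \<le> 1 / 8" by linarith
    then have "2 * \<tau> * max 0 (min 1 ((d x b - h) / w)) \<le> 2 * \<tau> * (1 / 8)"
      using \<tau> by (intro mult_left_mono) auto
    then show ?thesis unfolding s_def by simp
  qed
  have s_lip: "\<bar>s x - s y\<bar> \<le> \<delta> * \<tau> / 8" if "\<bar>d x b - d y b\<bar> \<le> t" for x y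
  proof -
    define u v where "u = (d x b - h) / w" and "v = (d y b - h) / w"
    have "\<bar>u - v\<bar> = \<bar>d x b - d y b\<bar> / w"
      using w by (simp add: u_def v_def diff_divide_distrib[symmetric] abs_divide)
    also have "\<dots> \<le> t / w" using that w by (intro divide_right_mono) auto
    also have "\<dots> = \<delta> / 16" using t \<delta> by (simp add: w_def)
    finally have "\<bar>u - v\<bar> \<le> \<delta> / 16" .
    then have uv: "\<bar>max 0 (min 1 u) - max 0 (min 1 v)\<bar> \<le> \<delta> / 16" by linarith
    have "\<bar>s x - s y\<bar> = 2 * \<tau> * \<bar>max 0 (min 1 u) - max 0 (min 1 v)\<bar>"
      unfolding s_def u_def v_def right_diff_distrib[symmetric] abs_mult using \<tau> by simp
    also have "\<dots> \<le> 2 * \<tau> * (\<delta> / 16)"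
      using \<tau> by (intro mult_left_mono[OF uv]) simp
    also have "\<dots> = \<delta> * \<tau> / 8" by simp
    finally show ?thesis .
  qed
  obtain \<A> :: "nat \<Rightarrow> ('b \<times> real) set set"
    where mesh: "\<And>c A p q. c < n \<Longrightarrow> A \<in> \<A> c \<Longrightarrow> p \<in> A \<Longrightarrow> q \<in> A \<Longrightarrow> max_metric \<rho> dist p q \<le> \<tau>"
      and sep: "\<And>c A B p q. c < n \<Longrightarrow> A \<in> \<A> c \<Longrightarrow> B \<in> \<A> c \<Longrightarrow> A \<noteq> B \<Longrightarrow> p \<in> A \<Longrightarrow> q \<in> B
           \<Longrightarrow> \<delta> * \<tau> / 4 \<le> max_metric \<rho> dist p q"
      and leb: "\<And>p. p \<in> Z \<times> {0..1} \<Longrightarrow> \<exists>c<n. \<exists>A\<in>\<A> c. P.mball p (\<delta> * \<tau> / 4) \<subseteq> A"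
  proof (rule P.LMn_covering_separated[OF cov \<delta>\<tau> less_imp_le[OF \<tau>]], goal_cases)
    case (1 \<A>)
    show ?case by (rule that[of \<A>, OF 1(2-4)])
  qed
  define S where "S = {x\<in>X. h \<le> d x b \<and> d x b < h + w + 2 * t}"
  \<comment> \<open>\<open>\<psi>\<close> need not be continuous, so these sets need not be open; interiors are taken after gluing.\<close>
  define \<F> where "\<F> c = (\<lambda>A. {x\<in>S. \<psi> x \<in> A}) ` \<A> c" for c
  have same_set: "\<rho> (\<phi> x) (\<phi> y) \<le> \<tau> \<and> \<bar>s x - s y\<bar> \<le> \<tau> \<and> x \<in> S \<and> y \<in> S"
    if "c < n" "U \<in> \<F> c" "x \<in> U" "y \<in> U" for c U x y
    using that mesh[of c _ "\<psi> x" "\<psi> y"] by (auto simp: \<F>_def \<psi>_def max_metric_def dist_real_def)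
  have other_set: "\<delta> * \<tau> / 4 \<le> max (\<rho> (\<phi> x) (\<phi> y)) \<bar>s x - s y\<bar>"
    if "c < n" "U \<in> \<F> c" "V \<in> \<F> c" "U \<noteq> V" "x \<in> U" "y \<in> V" for c U V x y
    using that sep[of c _ _ "\<psi> x" "\<psi> y"] by (fastforce simp: \<F>_def \<psi>_def max_metric_def dist_real_def)
  have diam: "d x y \<le> 2 * w + 7 * t" if "x \<in> S" "y \<in> S" "\<rho> (\<phi> x) (\<phi> y) \<le> \<tau>" for x y
  proof -
    \<comment> \<open>This is the \<open>g\<close> with \<open>\<tau> = a powr (- g)\<close>.\<close>
    define g where "g = h - t - (K + log a (8 / \<delta>))"
    have "0 \<le> log a (8 / \<delta>)" using a \<delta> by (simp add: zero_le_log_cancel_iff field_simps)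
    then have "g \<le> h" using t K by (simp add: g_def)
    have "d x y \<le> d x b + d y b - 2 * min (min (d x b) (d y b)) g + K"
      using that by (intro preimage_close) (auto simp: S_def \<tau>_def g_def algebra_simps)
    then show ?thesis
      using that \<open>g \<le> h\<close> large by (simp add: S_def g_def min_def split: if_splits)
  qed
  have "slab_family h w t \<tau> (\<delta> * \<tau> / 4) (2 * w + 7 * t) n \<F>"
    unfolding slab_family_def
  proof (intro conjI allI ballI impI)
    fix c U assume "c < n" "U \<in> \<F> c"
    then show "U \<subseteq> {x\<in>X. h \<le> d x b \<and> d x b < h + w + 2 * t}" by (auto simp: \<F>_def S_def)
  next
    fix c U x y assume U: "c < n" "U \<in> \<F> c" "x \<in> U" "y \<in> U"
    show "\<rho> (\<phi> x) (\<phi> y) \<le> \<tau>" using same_set[OF U] by simp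
    show "d x y \<le> 2 * w + 7 * t" using same_set[OF U] diam by blast
    show "\<not> (d x b < h + 2 * t \<and> h + w \<le> d y b)"
      using same_set[OF U] s_low[of x] s_top[of y] \<tau> by auto
  next
    fix c assume c: "c < n"
    show "disjoint (\<F> c)"
    proof (rule pairwiseI)
      fix U V assume UV: "U \<in> \<F> c" "V \<in> \<F> c" "U \<noteq> V"
      have False if "x \<in> U" "x \<in> V" for x
      proof -
        have "x \<in> X" using that UV by (auto simp: \<F>_def S_def)
        then have "\<rho> (\<phi> x) (\<phi> x) = 0" using \<phi> by simp
        then show False using other_set[OF c UV that] \<delta>\<tau> by simp
      qed
      then show "disjnt U V" by (auto simp: disjnt_def)
    qed
  next
    fix c U V x y
    assume UV: "c < n" "U \<in> \<F> c" "V \<in> \<F> c" "U \<noteq> V" "x \<in> U" "y \<in> V"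
      and "h + w \<le> d x b" "h + w \<le> d y b"
    then show "\<delta> * \<tau> / 4 \<le> \<rho> (\<phi> x) (\<phi> y)"
      using other_set[OF UV] s_top \<delta>\<tau> by simp
  next
    fix x assume x: "x \<in> X" "h + t \<le> d x b" "d x b < h + w + t"
    have "\<psi> x \<in> Z \<times> {0..1}" using \<phi>[OF x(1)] s01 unfolding \<psi>_def by blast
    from leb[OF this] obtain c A
      where A: "c < n" "A \<in> \<A> c" "P.mball (\<psi> x) (\<delta> * \<tau> / 4) \<subseteq> A" by blast
    have "X.mball x t \<subseteq> {x\<in>S. \<psi> x \<in> A}"
    proof
      fix y assume "y \<in> X.mball x t"
      then have y: "y \<in> X" "d x y < t" by auto
      have rad: "\<bar>d x b - d y b\<bar> < t"
        using X.triangle[OF x(1) y(1) b] X.triangle[OF y(1) x(1) b] X.commute[of x y] y(2) by linarith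
      have "\<rho> (\<phi> x) (\<phi> y) \<le> a powr (K + t - h)"
        using order_trans[OF image_close[OF x(1) y(1)] powr_mono, of "K + t - h"] a y(2) x(2) t by simp
      also have "\<dots> = \<delta> * \<tau> / 8"
      proof -
        have "\<tau> = a powr (log a (8 / \<delta>)) * a powr (K + t - h)"
          unfolding \<tau>_def powr_add[symmetric] by (simp add: algebra_simps)
        then show ?thesis using a \<delta> by simp
      qed
      finally have "max (\<rho> (\<phi> x) (\<phi> y)) \<bar>s x - s y\<bar> < \<delta> * \<tau> / 4"
        using s_lip[of x y] rad \<delta>\<tau> by simp
      then have "\<psi> y \<in> P.mball (\<psi> x) (\<delta> * \<tau> / 4)"
        using \<phi> x(1) y(1) s01[of x] s01[of y] by (simp add: \<psi>_def max_metric_def dist_real_def)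
      then show "y \<in> {x\<in>S. \<psi> x \<in> A}"
        using A y(1) rad x by (auto simp: S_def)
    qed
    then show "\<exists>c<n. \<exists>U\<in>\<F> c. X.mball x t \<subseteq> U"
      using A by (auto simp: \<F>_def)
  qed
  then show ?thesis by blast
qed

text \<open>
  Slab \<open>k\<close> starts at distance \<open>k * w\<close> from \<open>b\<close>.  Near \<open>b\<close> the shadows are too large for the scales
  at which \<open>Z \<times> [0,1]\<close> has coverings, so slab \<open>0\<close> is a ball taken as a single set.  Scales drop by
  the factor \<open>a powr (- w)\<close> from one slab to the next, so a set of one slab is too small to meet two sets of the
  same colour in the slab before, and the families can be glued colour by colour.  Gluing triples the
  diameter bound \<open>2 * w + 7 * t = (32 / \<delta> + 7) * t\<close> of the slab families.
\<close>

lemma LMn_covering_exists: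
  assumes \<delta>: "0 < \<delta>" "\<delta> < 1" and t: "t > 0" and large: "2 * (K + log a (8 / \<delta>)) + K \<le> t"
    and small: "a powr (- t) < \<tau>0" "a powr (- t) < 1 / 2" "a powr (- t) < \<delta> / 4" and n: "n > 0"
    and cov: "\<And>\<tau>. 0 < \<tau> \<Longrightarrow> \<tau> < \<tau>0 \<Longrightarrow>
      \<exists>\<U>. Metric_space.LMn_covering (Z \<times> {0..1::real}) (max_metric \<rho> dist) (\<delta> * \<tau>) \<tau> n \<U>"
  shows "\<exists>\<U>. X.LMn_covering t (3 * (32 / \<delta> + 7) * t) n \<U>"
proof -
  define w where "w = 16 / \<delta> * t"
  define \<tau> where "\<tau> k = a powr (K + log a (8 / \<delta>) + t - real k * w)" for k :: nat
  define m where "m = 2 * w + 7 * t"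
  have w16: "16 * t \<le> w"
    using t \<delta> by (simp add: w_def field_simps)
  have level_mono: "real k * w + 2 * w \<le> real l * w" if "k + 2 \<le> l" for k l
  proof -
    have "(real k + 2) * w \<le> real l * w" using that w16 t by (intro mult_right_mono) auto
    then show ?thesis by (simp add: algebra_simps)
  qed
  have \<tau>_pos: "\<tau> k > 0" for k using a by (simp add: \<tau>_def)
  have \<tau>_small: "\<tau> k \<le> a powr (- t)" if "k \<ge> 1" for k
  proof -
    have "1 * w \<le> real k * w" using that w16 t by (intro mult_right_mono) auto
    moreover have "K + log a (8 / \<delta>) \<le> t"
      using large K t a \<delta> zero_le_log_cancel_iff[of a "8 / \<delta>"] by (simp add: field_simps)
    ultimately show ?thesis
      unfolding \<tau>_def using a t w16 by (intro powr_mono) linarith+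
  qed
  have \<tau>_Suc: "\<tau> (Suc k) < \<delta> * \<tau> k / 4" for k
  proof -
    have "\<tau> (Suc k) = a powr (- w) * \<tau> k"
      unfolding \<tau>_def powr_add[symmetric] by (simp add: algebra_simps)
    moreover have "a powr (- w) \<le> a powr (- t)" using a t w16 by (intro powr_mono) auto
    ultimately show ?thesis using small(3) \<tau>_pos[of k] by simp
  qed
  have "\<exists>\<F>. slab_family (real k * w) w t (\<tau> k) (\<delta> * \<tau> k / 4) m n \<F>" if k: "k \<ge> 1" for k
  proof -
    have "\<tau> k < \<tau>0" "2 * \<tau> k \<le> 1" using \<tau>_small[OF k] small by linarith+
    then show ?thesis
      using slab_family_exists[OF \<delta> t large \<tau>_def _ w_def] cov[OF \<tau>_pos] unfolding m_def by blast
  qed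
  then obtain \<F> where \<F>: "\<And>k. k \<ge> 1 \<Longrightarrow> slab_family (real k * w) w t (\<tau> k) (\<delta> * \<tau> k / 4) m n (\<F> k)"
    by metis
  note slab = \<F>[unfolded slab_family_def]
  define B where "B = {x\<in>X. d x b < w + 2 * t}"
  define F where "F c k = (if k = 0 then {B} else \<F> k c)" for c k
  have F_level: "x \<in> X \<and> real k * w \<le> d x b \<and> d x b < real k * w + w + 2 * t"
    if "c < n" "U \<in> F c k" "x \<in> U" for c k U x
  proof (cases "k = 0")
    case True
    then show ?thesis using that by (simp add: F_def B_def)
  next
    case False
    then have "U \<subseteq> {x\<in>X. real k * w \<le> d x b \<and> d x b < real k * w + w + 2 * t}"
      using that slab[of k] by (simp add: F_def)
    then show ?thesis using that by blast
  qed
  have F_diam: "d x y \<le> m" if "c < n" "U \<in> F c k" "x \<in> U" "y \<in> U" for c k U x y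
  proof (cases "k = 0")
    case True
    then have "x \<in> X" "y \<in> X" "d x b < w + 2 * t" "d y b < w + 2 * t"
      using that by (auto simp: F_def B_def)
    then show ?thesis
      using X.triangle[of x b y] b X.commute[of y b] t by (simp add: m_def)
  next
    case False
    then show ?thesis using that slab[of k] by (simp add: F_def)
  qed
  have F_gluing: "gluing (F c)" if c: "c < n" for c
  proof
    fix k show "disjoint (F c k)"
      using slab[of k] c by (simp add: F_def)
  next
    fix k l U V assume kl: "k + 2 \<le> l" and UV: "U \<in> F c k" "V \<in> F c l"
    show "U \<inter> V = {}"
    proof (rule ccontr)
      assume "U \<inter> V \<noteq> {}"
      then obtain x where "x \<in> U" "x \<in> V" by blast
      then have "d x b < real k * w + w + 2 * t" "real l * w \<le> d x b"
        using F_level[OF c UV(1)] F_level[OF c UV(2)] by auto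
      then show False using level_mono[OF kl] w16 t by linarith
    qed
  next
    fix k U U' V
    assume U: "U \<in> F c k" "U' \<in> F c k" and V: "V \<in> F c (Suc k)" and meet: "V \<inter> U \<noteq> {}" "V \<inter> U' \<noteq> {}"
    show "U = U'"
    proof (cases "k = 0")
      case True
      then show ?thesis using U by (simp add: F_def)
    next
      case False
      obtain x y where xy: "x \<in> V" "x \<in> U" "y \<in> V" "y \<in> U'" using meet by blast
      have "real k * w + w \<le> d x b" "real k * w + w \<le> d y b"
        using F_level[OF c V] xy by (auto simp: algebra_simps)
      moreover have "\<rho> (\<phi> x) (\<phi> y) \<le> \<tau> (Suc k)"
        using slab[of "Suc k"] c V xy by (simp add: F_def)
      ultimately show ?thesis
        using slab[of k] c U xy False \<tau>_Suc[of k] by (fastforce simp: F_def)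
    qed
  next
    fix k U V W
    assume U: "U \<in> F c k" and V: "V \<in> F c (Suc k)" and W: "W \<in> F c (Suc (Suc k))" and "V \<inter> U \<noteq> {}"
    then obtain x where x: "x \<in> V" "x \<in> U" by blast
    show "W \<inter> V = {}"
    proof (rule ccontr)
      assume "W \<inter> V \<noteq> {}"
      then obtain y where y: "y \<in> V" "y \<in> W" by blast
      have "d x b < real (Suc k) * w + 2 * t" "real (Suc k) * w + w \<le> d y b"
        using F_level[OF c U x(2)] F_level[OF c W y(2)] by (auto simp: algebra_simps)
      then show False
        using slab[of "Suc k"] c V x y by (auto simp: F_def)
    qed
  qed
  have "\<exists>\<U>. X.LMn_covering t (3 * m) n \<U>"
  proof (rule X.LMn_covering_interiors[where \<G> = "\<lambda>c. glued (F c)"])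
    fix c assume c: "c < n"
    show "disjoint (glued (F c))"
      using F_gluing[OF c] by (rule gluing.disjoint_glued)
  next
    fix c G x y assume c: "c < n" and G: "G \<in> glued (F c)" "x \<in> G" "y \<in> G"
    show "d x y \<le> 3 * m"
    proof (rule X.glued_diam[OF _ _ G])
      show "m \<ge> 0" using w16 t by (simp add: m_def)
    qed (use F_level[OF c] F_diam[OF c] in blast)+
  next
    fix x assume x: "x \<in> X"
    have "\<exists>c<n. \<exists>k. \<exists>U\<in>F c k. X.mball x t \<subseteq> U"
    proof (cases "d x b < w + t")
      case True
      have "X.mball x t \<subseteq> B"
      proof
        fix y assume "y \<in> X.mball x t"
        then show "y \<in> B"
          using True X.triangle[of y x b] X.commute[of x y] x b by (auto simp: B_def)
      qed
      then show ?thesis using n by (intro exI[of _ 0] conjI) (simp_all add: F_def)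
    next
      case False
      have w: "w > 0" using w16 t by linarith
      define k where "k = nat \<lfloor>(d x b - t) / w\<rfloor>"
      have q: "1 \<le> (d x b - t) / w" using False w by (simp add: field_simps)
      then have k: "k \<ge> 1" unfolding k_def by (simp add: le_nat_iff)
      have "real k = of_int \<lfloor>(d x b - t) / w\<rfloor>" using q by (simp add: k_def)
      then have "real k \<le> (d x b - t) / w" "(d x b - t) / w < real k + 1" by linarith+
      then have "real k * w + t \<le> d x b" "d x b < real k * w + w + t"
        unfolding pos_le_divide_eq[OF w] pos_divide_less_eq[OF w] by (simp_all add: algebra_simps)
      then have "\<exists>c<n. \<exists>U\<in>\<F> k c. X.mball x t \<subseteq> U"
        using slab[OF k] x by simp
      then obtain c U where "c < n" "U \<in> \<F> k c" "X.mball x t \<subseteq> U" by blast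
      then show ?thesis using k by (intro exI[of _ c] conjI exI[of _ k]) (auto simp: F_def)
    qed
    then show "\<exists>c<n. \<exists>U\<in>glued (F c). X.mball x t \<subseteq> U"
      using gluing.subset_glued[OF F_gluing] by (meson order_trans)
  qed (rule t)
  moreover have "3 * m = 3 * (32 / \<delta> + 7) * t"
    by (simp add: m_def w_def algebra_simps)
  ultimately show ?thesis by simp
qed

lemma l_asdim_le_l_dim_product:
  "X.l_asdim \<le> Metric_space.l_dim (Z \<times> {0..1::real}) (max_metric \<rho> dist)"
proof -
  have dist01: "Metric_space {0..1::real} dist"
    by (rule Metric_space.subspace[OF Met_TC.Metric_space_axioms]) simp
  interpret P: Metric_space "Z \<times> {0..1::real}" "max_metric \<rho> dist"
    by (rule Metric_space_max_metric[OF Z.Metric_space_axioms dist01])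
  have "\<exists>C>1. \<forall>\<^sub>F t in at_top. \<exists>\<U>. X.LMn_covering t (C * t) (n + 1) \<U>"
    if \<delta>: "0 < \<delta>" "\<delta> < 1"
      and ev: "\<forall>\<^sub>F \<tau> in at_right 0. \<exists>\<U>. P.LMn_covering (\<delta> * \<tau>) \<tau> (n + 1) \<U>" for n \<delta>
  proof -
    obtain \<tau>0 where \<tau>0: "\<tau>0 > 0"
      and cov: "\<And>\<tau>. 0 < \<tau> \<Longrightarrow> \<tau> < \<tau>0 \<Longrightarrow> \<exists>\<U>. P.LMn_covering (\<delta> * \<tau>) \<tau> (n + 1) \<U>"
      using ev unfolding eventually_at_right_field by blast
    have small: "\<forall>\<^sub>F t in at_top. a powr (- t) < e" if "e > 0" for e
      using eventually_gt_at_top[of "- log a e"]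
    proof eventually_elim
      case (elim t)
      then have "- t < log a e" by simp
      then show ?case using a that by (simp add: less_log_iff)
    qed
    define T where "T = 2 * (K + log a (8 / \<delta>)) + K"
    have "\<forall>\<^sub>F t in at_top. \<exists>\<U>. X.LMn_covering t (3 * (32 / \<delta> + 7) * t) (n + 1) \<U>"
      using eventually_gt_at_top[of 0] eventually_ge_at_top[of T] small[OF \<tau>0] small[of "1 / 2", simplified]
        small[OF divide_pos_pos[OF \<delta>(1), of 4], simplified]
    proof eventually_elim
      case (elim t)
      show ?case
        using elim cov by (intro LMn_covering_exists[OF \<delta>, of t \<tau>0]) (auto simp: T_def)
    qed
    moreover have "3 * (32 / \<delta> + 7) > 1" using \<delta> by (simp add: add_pos_pos field_simps)
    ultimately show ?thesis by blast
  qed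
  then show ?thesis
    unfolding X.l_asdim_def P.l_dim_def by (intro Inf_superset_mono) blast
qed

end

theorem theorem1p5:
  fixes X :: "'a set" and dX :: "'a \<Rightarrow> 'a \<Rightarrow> real"
    and \<rho> :: "(nat \<Rightarrow> 'a) set \<Rightarrow> (nat \<Rightarrow> 'a) set \<Rightarrow> real"
  assumes "Metric_space X dX"
    and "Metric_space.gromov_hyperbolic X dX"
    and "Metric_space.visual_space X dX"
    and "Metric_space.visual_metric X dX \<rho>"
  shows "Metric_space.l_asdim X dX
    \<le> Metric_space.l_dim (Metric_space.boundary_at_infinity X dX \<times> {0..1::real})
        (max_metric \<rho> dist)"
proof -
  interpret X: Metric_space X dX by fact
  interpret Z: Metric_space X.boundary_at_infinity \<rho>
    using assms(4) unfolding X.visual_metric_def by blast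
  obtain b \<phi> a K where "b \<in> X" "a > 1" "K \<ge> 0" "\<And>x. x \<in> X \<Longrightarrow> \<phi> x \<in> X.boundary_at_infinity"
    and "\<And>x y. x \<in> X \<Longrightarrow> y \<in> X \<Longrightarrow> \<rho> (\<phi> x) (\<phi> y) \<le> a powr (K + dX x y - dX x b)"
    and "\<And>x y g. x \<in> X \<Longrightarrow> y \<in> X \<Longrightarrow> \<rho> (\<phi> x) (\<phi> y) \<le> a powr (- g)
      \<Longrightarrow> dX x y \<le> dX x b + dX y b - 2 * min (min (dX x b) (dX y b)) g + K"
    using X.boundary_projection[OF assms(2-4)] by metis
  then interpret hyperbolic_projection X dX X.boundary_at_infinity \<rho> b \<phi> a K
    by unfold_locales
  show ?thesis by (rule l_asdim_le_l_dim_product)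
qed

end
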